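(* Let $\mathtt{X} \in \{\mathtt{CS}, \mathtt{S}\}$, with $\mathcal{E}_{\mathtt{CS}} = \mathcal{E}_1 \cup \{\mathrm{CS},\mathrm{CSP1},\mathrm{CSP2},\mathrm{EL1}\}$ and $\mathcal{E}_{\mathtt{S}} = \mathcal{E}_1\cup\{\mathrm{S},\mathrm{SP1},\mathrm{SP2},\mathrm{EL1}\}$. Then for all closed $\mathrm{BCCSP}_{\|}$ terms $p,q$: $p\sim_{\mathtt{X}} q$ if and only if $\mathcal{E}_{\mathtt{X}}\vdash p\approx q$.
   Context: Let $\mathcal{A}$ be a finite non-empty set of actions and $\mathcal{V}$ a countably infinite set of variables. $\mathrm{BCCSP}_{\|}$ terms are generated by $t ::= \mathbf{0} \mid x \mid a.t \mid t+t \mid t \,\|\, t$ with $a\in\mathcal{A}$, $x \in \mathcal{V}$ ($ax$ means $a.x$; prefixing binds strongest, $+$ weakest). Closed terms are called processes. Transitions on processes: $a.p \xrightarrow{a} p$; if $p \xrightarrow{a} p'$ then $p+q \xrightarrow{a} p'$, $q+p \xrightarrow{a} p'$, $p\|q \xrightarrow{a} p'\|q$, $q \| p \xrightarrow{a} q \| p'$. $\mathtt{I}(p)=\{a \mid \exists p'.\, p \xrightarrow{a} p'\}$. A simulation is a relation $R$ on processes with: $pRq$ and $p\xrightarrow{a}p'$ imply $q\xrightarrow{a}q'$ and $p'Rq'$ for some $q'$. A completed simulation is a simulation $R$ such that $pRq$ and $\mathtt{I}(p)=\emptyset$ imply $\mathtt{I}(q)=\emptyset$. $p\sqsubseteq_{\mathtt{S}}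 q$ (resp. $p\sqsubseteq_{\mathtt{CS}} q$) iff $pRq$ for some simulation (resp. completed simulation) $R$; $\sim_{\mathtt{S}}$ and $\sim_{\mathtt{CS}}$ are the kernels $\sqsubseteq\cap\sqsubseteq^{-1}$. $\mathcal{E}\vdash t\approx u$ means derivable in equational logic (reflexivity, symmetry, transitivity, substitution instances of axioms, closure under $a.\_$, $+$, $\|$). Axioms with concrete action names stand for all instances with actions from $\mathcal{A}$. $\mathcal{E}_1$: A0 $x+\mathbf{0}\approx x$; A1 $x+y\approx y+x$; A2 $(x+y)+z \approx x+(y+z)$; A3 $x+x\approx x$; P0 $x\|\mathbf{0}\approx x$; P1 $x\|y \approx y \| x$. CS: $a(bx+y+z)\approx a(bx+y+z)+a(bx+z)$. CSP1: $(ax+by+u)\|(cz+dw+v)\approx (ax+u)\|(cz+dw+v)+(by+u)\|(cz+dw+v)+(ax+by+u)\|(cz+v)+(ax+by+u)\|(dw+v)$. CSP2: $ax\|(by+cz+w)\approx a(x\|(by+cz+w))+ax\|(by+w)+ax\|(cz+w)$. EL1: $ax\|by\approx a(x\|by)+b(ax\|y)$. S: $a(x+y)\approx a(x+y)+ax$. SP1: $(x+y)\|(z+w)\approx x\|(z+w)+y\|(z+w)+(x+y)\|z+(x+y)\|w$. SP2: $ax\|(y+z)\approx a(x\|(y+z))+ax\|y+ax\|z$. *)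

theory Defs
  imports Main
begin

datatype 'a trm =
    Zero                          ("\<zero>")
  | Var nat
  | Prefix 'a "'a trm"            (infixr "\<cdot>" 80)
  | Par "'a trm" "'a trm"         (infixl "\<parallel>" 70)
  | Plus "'a trm" "'a trm"        (infixl "\<oplus>" 65)

fun process :: "'a trm \<Rightarrow> bool" where
  "process \<zero> \<longleftrightarrow> True"
| "process (Var n) \<longleftrightarrow> False"
| "process (a \<cdot> t) \<longleftrightarrow> process t"
| "process (t \<oplus> u) \<longleftrightarrow> process t \<and> process u"
| "process (t \<parallel> u) \<longleftrightarrow> process t \<and> process u"

fun subst :: "(nat \<Rightarrow> 'a trm) \<Rightarrow> 'a trm \<Rightarrow> 'a trm" where
  "subst \<sigma> \<zero> = \<zero>"
| "subst \<sigma> (Var n) = \<sigma> n"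
| "subst \<sigma> (a \<cdot> t) = a \<cdot> subst \<sigma> t"
| "subst \<sigma> (t \<oplus> u) = subst \<sigma> t \<oplus> subst \<sigma> u"
| "subst \<sigma> (t \<parallel> u) = subst \<sigma> t \<parallel> subst \<sigma> u"

text \<open>The rules are stated for all terms, but only transitions of processes are used below.
  The rules whose conclusion has a process as source only involve processes, so restricting
  them to processes would yield the same transitions.\<close>

inductive step :: "'a trm \<Rightarrow> 'a \<Rightarrow> 'a trm \<Rightarrow> bool" where
  step_prefix: "step (a \<cdot> p) a p"
| step_plusL: "step p a p' \<Longrightarrow> step (p \<oplus> q) a p'"
| step_plusR: "step p a p' \<Longrightarrow> step (q \<oplus> p) a p'"
| step_parL: "step p a p' \<Longrightarrow> step (p \<parallel> q) a (p' \<parallel> q)"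
| step_parR: "step p a p' \<Longrightarrow> step (q \<parallel> p) a (q \<parallel> p')"

definition initials :: "'a trm \<Rightarrow> 'a set" where
  "initials p = {a. \<exists>p'. step p a p'}"

definition simulation :: "('a trm \<Rightarrow> 'a trm \<Rightarrow> bool) \<Rightarrow> bool" where
  "simulation R \<longleftrightarrow>
     (\<forall>p q. R p q \<longrightarrow> process p \<and> process q) \<and>
     (\<forall>p q a p'. R p q \<and> step p a p' \<longrightarrow> (\<exists>q'. step q a q' \<and> R p' q'))"

definition completed_simulation :: "('a trm \<Rightarrow> 'a trm \<Rightarrow> bool) \<Rightarrow> bool" where
  "completed_simulation R \<longleftrightarrow>
     simulation R \<and> (\<forall>p q. R p q \<and> initials p = {} \<longrightarrow> initials q = {})"

datatype semantics = CS | S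

fun preord :: "semantics \<Rightarrow> 'a trm \<Rightarrow> 'a trm \<Rightarrow> bool" where
  "preord S p q \<longleftrightarrow> (\<exists>R. simulation R \<and> R p q)"
| "preord CS p q \<longleftrightarrow> (\<exists>R. completed_simulation R \<and> R p q)"

definition sem_equiv :: "'a trm \<Rightarrow> semantics \<Rightarrow> 'a trm \<Rightarrow> bool"
    ("(_ \<sim>[_] _)" [51, 0, 51] 50) where
  "p \<sim>[X] q \<longleftrightarrow> preord X p q \<and> preord X q p"

type_synonym 'a eqn = "'a trm \<times> 'a trm"

inductive derivable :: "'a eqn set \<Rightarrow> 'a trm \<Rightarrow> 'a trm \<Rightarrow> bool"
    ("(_ \<turnstile> _ \<approx> _)" [51, 51, 51] 50) for E where
  refl: "E \<turnstile> t \<approx> t"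
| sym: "E \<turnstile> t \<approx> u \<Longrightarrow> E \<turnstile> u \<approx> t"
| trans: "E \<turnstile> t \<approx> u \<Longrightarrow> E \<turnstile> u \<approx> v \<Longrightarrow> E \<turnstile> t \<approx> v"
| ax: "(t, u) \<in> E \<Longrightarrow> E \<turnstile> subst \<sigma> t \<approx> subst \<sigma> u"
| cong_prefix: "E \<turnstile> t \<approx> u \<Longrightarrow> E \<turnstile> a \<cdot> t \<approx> a \<cdot> u"
| cong_plus: "E \<turnstile> t \<approx> u \<Longrightarrow> E \<turnstile> t' \<approx> u' \<Longrightarrow> E \<turnstile> t \<oplus> t' \<approx> u \<oplus> u'"
| cong_par: "E \<turnstile> t \<approx> u \<Longrightarrow> E \<turnstile> t' \<approx> u' \<Longrightarrow> E \<turnstile> t \<parallel> t' \<approx> u \<parallel> u'"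

text \<open>The pairwise distinct variables \<open>x\<close>, \<open>y\<close>, \<open>z\<close>, \<open>w\<close>, \<open>u\<close>, \<open>v\<close> of the axioms.\<close>

abbreviation "vx \<equiv> Var 0"
abbreviation "vy \<equiv> Var 1"
abbreviation "vz \<equiv> Var 2"
abbreviation "vw \<equiv> Var 3"
abbreviation "vu \<equiv> Var 4"
abbreviation "vv \<equiv> Var 5"

definition E1 :: "'a eqn set" where
  "E1 =
    {(vx \<oplus> \<zero>, vx),
     (vx \<oplus> vy, vy \<oplus> vx),
     ((vx \<oplus> vy) \<oplus> vz, vx \<oplus> (vy \<oplus> vz)),
     (vx \<oplus> vx, vx),
     (vx \<parallel> \<zero>, vx),
     (vx \<parallel> vy, vy \<parallel> vx)}"

definition ax_EL1 :: "'a eqn set" where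
  "ax_EL1 =
    {(a\<cdot>vx \<parallel> b\<cdot>vy, a\<cdot>(vx \<parallel> b\<cdot>vy) \<oplus> b\<cdot>(a\<cdot>vx \<parallel> vy)) | a b. True}"

definition ax_CS :: "'a eqn set" where
  "ax_CS =
    {(a\<cdot>(b\<cdot>vx \<oplus> vy \<oplus> vz),
      a\<cdot>(b\<cdot>vx \<oplus> vy \<oplus> vz) \<oplus> a\<cdot>(b\<cdot>vx \<oplus> vz)) | a b. True}"

definition ax_CSP1 :: "'a eqn set" where
  "ax_CSP1 =
    {((a\<cdot>vx \<oplus> b\<cdot>vy \<oplus> vu) \<parallel> (c\<cdot>vz \<oplus> d\<cdot>vw \<oplus> vv),
      (a\<cdot>vx \<oplus> vu) \<parallel> (c\<cdot>vz \<oplus> d\<cdot>vw \<oplus> vv)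
      \<oplus> (b\<cdot>vy \<oplus> vu) \<parallel> (c\<cdot>vz \<oplus> d\<cdot>vw \<oplus> vv)
      \<oplus> (a\<cdot>vx \<oplus> b\<cdot>vy \<oplus> vu) \<parallel> (c\<cdot>vz \<oplus> vv)
      \<oplus> (a\<cdot>vx \<oplus> b\<cdot>vy \<oplus> vu) \<parallel> (d\<cdot>vw \<oplus> vv)) | a b c d. True}"

definition ax_CSP2 :: "'a eqn set" where
  "ax_CSP2 =
    {(a\<cdot>vx \<parallel> (b\<cdot>vy \<oplus> c\<cdot>vz \<oplus> vw),
      a\<cdot>(vx \<parallel> (b\<cdot>vy \<oplus> c\<cdot>vz \<oplus> vw))
      \<oplus> a\<cdot>vx \<parallel> (b\<cdot>vy \<oplus> vw)
      \<oplus> a\<cdot>vx \<parallel> (c\<cdot>vz \<oplus> vw)) | a b c. True}"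

definition ax_S :: "'a eqn set" where
  "ax_S = {(a\<cdot>(vx \<oplus> vy), a\<cdot>(vx \<oplus> vy) \<oplus> a\<cdot>vx) | a. True}"

definition ax_SP1 :: "'a eqn set" where
  "ax_SP1 =
    {((vx \<oplus> vy) \<parallel> (vz \<oplus> vw),
      vx \<parallel> (vz \<oplus> vw) \<oplus> vy \<parallel> (vz \<oplus> vw)
      \<oplus> (vx \<oplus> vy) \<parallel> vz \<oplus> (vx \<oplus> vy) \<parallel> vw)}"

definition ax_SP2 :: "'a eqn set" where
  "ax_SP2 =
    {(a\<cdot>vx \<parallel> (vy \<oplus> vz),
      a\<cdot>(vx \<parallel> (vy \<oplus> vz)) \<oplus> a\<cdot>vx \<parallel> vy \<oplus> a\<cdot>vx \<parallel> vz) | a. True}"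

fun axioms_of :: "semantics \<Rightarrow> 'a eqn set" where
  "axioms_of CS = E1 \<union> ax_CS \<union> ax_CSP1 \<union> ax_CSP2 \<union> ax_EL1"
| "axioms_of S = E1 \<union> ax_S \<union> ax_SP1 \<union> ax_SP2 \<union> ax_EL1"

end

theory Submission imports Defs begin

text \<open>The axioms of \<open>S\<close> derive those of \<open>CS\<close>: idempotence allows the context \<open>u\<close> of
  \<open>ax \<oplus> by \<oplus> u\<close> to be duplicated, so that \<open>SP1\<close>, \<open>SP2\<close> and \<open>S\<close> yield \<open>CSP1\<close>, \<open>CSP2\<close> and \<open>CS\<close>.
  Both systems are therefore treated at once. \<open>CSP1\<close>, \<open>CSP2\<close> and \<open>EL1\<close> reduce a parallel
  composition of sums of prefixes to smaller ones, so every process equals a parallel-free one.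
  For parallel-free processes, \<open>p \<sqsubseteq> q\<close> implies \<open>q \<approx> q \<oplus> p\<close>: a summand \<open>a\<cdot>p'\<close> of \<open>p\<close> is matched by
  some \<open>a\<cdot>q'\<close> with \<open>p' \<sqsubseteq> q'\<close>, hence \<open>q' \<approx> q' \<oplus> p'\<close>, and \<open>CS\<close> absorbs \<open>a\<cdot>p'\<close> into
  \<open>a\<cdot>(q' \<oplus> p')\<close>.\<close>

section \<open>Soundness\<close>

lemma step_simps [simp]:
  "\<not> step \<zero> a r"
  "\<not> step (Var n) a r"
  "step (b \<cdot> p) a r \<longleftrightarrow> a = b \<and> r = p"
  "step (p \<oplus> q) a r \<longleftrightarrow> step p a r \<or> step q a r"
  "step (p \<parallel> q) a r \<longleftrightarrow>
     (\<exists>p'. step p a p' \<and> r = p' \<parallel> q) \<or> (\<exists>q'. step q a q' \<and> r = p \<parallel> q')"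
  by (auto elim: step.cases intro: step.intros)

lemma initials_simps [simp]:
  "initials \<zero> = {}"
  "initials (Var n) = {}"
  "initials (a \<cdot> p) = {a}"
  "initials (p \<oplus> q) = initials p \<union> initials q"
  "initials (p \<parallel> q) = initials p \<union> initials q"
  by (auto simp: initials_def)

lemma process_step: "step p a p' \<Longrightarrow> process p \<Longrightarrow> process p'"
  by (induction rule: step.induct) auto

text \<open>The preorder on all terms, with variables as deadlocked: derivations between processes may
  pass through open terms.\<close>

coinductive below :: "semantics \<Rightarrow> 'a trm \<Rightarrow> 'a trm \<Rightarrow> bool" for X where
  belowI: "(\<And>a p'. step p a p' \<Longrightarrow> \<exists>q'. step q a q' \<and> below X p' q') \<Longrightarrow>
    (X = CS \<Longrightarrow> initials p = {} \<Longrightarrow> initials q = {}) \<Longrightarrow> below X p q"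

lemma below_step: "below X p q \<Longrightarrow> step p a p' \<Longrightarrow> \<exists>q'. step q a q' \<and> below X p' q'"
  by (auto elim: below.cases)

lemma below_initials: "below CS p q \<Longrightarrow> initials p = {} \<Longrightarrow> initials q = {}"
  by (auto elim: below.cases)

text \<open>Coinduction with the transfer of transitions and the deadlock condition as separate
  premises; the second concerns only \<open>X = CS\<close>, so both preorders share each
  proof.\<close>

lemma below_coinduct:
  assumes "R p q"
    and "\<And>p q a p'. R p q \<Longrightarrow> step p a p' \<Longrightarrow> \<exists>q'. step q a q' \<and> R p' q'"
    and "\<And>p q. X = CS \<Longrightarrow> R p q \<Longrightarrow> initials p = {} \<Longrightarrow> initials q = {}"
  shows "below X p q"
  using assms(1) by (rule below.coinduct[of R]) (use assms(2,3) in metis)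

lemma preord_imp_below:
  assumes "preord X p q"
  shows "below X p q"
proof -
  \<comment> \<open>For \<open>X = S\<close> the second fact about \<open>R\<close> is vacuous; for
    \<open>X = CS\<close> a completed simulation is in particular a simulation.\<close>
  obtain R where "R p q" and R: "simulation R" "X = CS \<Longrightarrow> completed_simulation R"
    using assms by (cases X) (auto simp: completed_simulation_def)
  from \<open>R p q\<close> show ?thesis
  proof (rule below_coinduct)
    show "\<exists>q'. step q a q' \<and> R p' q'" if "R p q" "step p a p'" for p q a p'
      using R(1) that unfolding simulation_def by blast
    show "initials q = {}" if "X = CS" "R p q" "initials p = {}" for p q
      using R(2) that unfolding completed_simulation_def by blast
  qed
qed

lemma preord_iff_below:
  assumes "process p" "process q"
  shows "preord X p q \<longleftrightarrow> below X p q"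
proof
  assume "below X p q"
  \<comment> \<open>A simulation may relate processes only, so \<open>below\<close> is restricted to
    them; the restriction survives because derivatives of processes are processes.\<close>
  define R where "R r s \<longleftrightarrow> process r \<and> process s \<and> below X r s" for r s :: "'a trm"
  have sim: "simulation R"
    unfolding simulation_def
  proof (intro conjI allI impI)
    fix r s a r'
    assume rs: "R r s \<and> step r a r'"
    then have r: "process r" "process s" "below X r s" "step r a r'"
      by (simp_all add: R_def)
    then obtain s' where "step s a s'" "below X r' s'"
      using below_step[of X r s] by auto
    then show "\<exists>s'. step s a s' \<and> R r' s'"
      using r process_step[of r a r'] process_step[of s a s'] by (auto simp: R_def)
  qed (simp_all add: R_def)
  moreover have "completed_simulation R" if "X = CS"
    using sim that below_initials unfolding completed_simulation_def R_def by auto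
  moreover have "R p q"
    using assms \<open>below X p q\<close> by (simp add: R_def)
  ultimately show "preord X p q"
    by (cases X) auto
qed (rule preord_imp_below)

section \<open>The preorder is a precongruence\<close>

lemma below_refl [simp]: "below X p p"
  by (rule below_coinduct[of "(=)"]) auto

lemma below_trans:
  fixes p q r :: "'a trm"
  assumes "below X p q" "below X q r"
  shows "below X p r"
proof (rule below_coinduct)
  let ?R = "\<lambda>p r :: 'a trm. \<exists>q. below X p q \<and> below X q r"
  show "?R p r" using assms by blast
  show "\<exists>r'. step r a r' \<and> ?R p' r'" if R: "?R p r" and step: "step p a p'" for p r a p'
  proof -
    obtain q where q: "below X p q" "below X q r" using R by blast
    obtain q' where "step q a q'" "below X p' q'" using below_step[OF q(1) step] by blast
    moreover obtain r' where "step r a r'" "below X q' r'"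
      using below_step[OF q(2) \<open>step q a q'\<close>] by blast
    ultimately show ?thesis by blast
  qed
  show "initials r = {}" if "X = CS" "?R p r" "initials p = {}" for p r
    using that below_initials by blast
qed

lemma below_prefix: "below X p q \<Longrightarrow> below X (a \<cdot> p) (a \<cdot> q)"
  by (rule belowI) auto

lemma below_plus:
  assumes "below X p p'" "below X q q'"
  shows "below X (p \<oplus> q) (p' \<oplus> q')"
proof (rule belowI)
  show "\<exists>r'. step (p' \<oplus> q') a r' \<and> below X r r'" if "step (p \<oplus> q) a r" for a r
    using that below_step[OF assms(1)] below_step[OF assms(2)] by (metis step_simps(4))
  show "initials (p' \<oplus> q') = {}" if "X = CS" "initials (p \<oplus> q) = {}"
    using that assms below_initials by auto
qed

lemma below_par:
  assumes "below X p p'" "below X q q'"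
  shows "below X (p \<parallel> q) (p' \<parallel> q')"
proof -
  \<comment> \<open>A derivative of a parallel composition is again one, with one component changed,
    so the componentwise comparison is itself closed under transitions.\<close>
  define R where "R r s \<longleftrightarrow>
    (\<exists>p q p' q'. r = p \<parallel> q \<and> s = p' \<parallel> q' \<and> below X p p' \<and> below X q q')" for r s :: "'a trm"
  have RI: "R (p \<parallel> q) (p' \<parallel> q')" if "below X p p'" "below X q q'" for p p' q q'
    using that unfolding R_def by blast
  show ?thesis
  proof (rule below_coinduct)
    show "R (p \<parallel> q) (p' \<parallel> q')" using assms by (rule RI)
    show "\<exists>s'. step s a s' \<and> R r' s'" if rs: "R r s" and step: "step r a r'" for r s a r'
    proof -
      obtain p q p' q' where r: "r = p \<parallel> q" and s: "s = p' \<parallel> q'"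
        and below: "below X p p'" "below X q q'"
        using rs unfolding R_def by blast
      from step consider p1 where "step p a p1" "r' = p1 \<parallel> q" | q1 where "step q a q1" "r' = p \<parallel> q1"
        unfolding r by auto
      then show ?thesis
        unfolding s by cases (metis below below_step RI step_parL step_parR)+
    qed
    show "initials s = {}" if "X = CS" "R r s" "initials r = {}" for r s
      using that below_initials unfolding R_def by fastforce
  qed
qed

lemma below_stepI:
  assumes "\<And>a p'. step p a p' \<Longrightarrow> step q a p'"
    and "X = CS \<Longrightarrow> initials p = {} \<Longrightarrow> initials q = {}"
  shows "below X p q"
  using assms by (intro belowI) (metis below_refl)+

text \<open>Each transition of a sum belongs to a summand, and a deadlocked sum has deadlocked
  summands. Hence the sums on the right of the axioms can be checked one summand at a time.\<close>

lemma below_plus_least: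
  assumes "below X p r" "below X q r"
  shows "below X (p \<oplus> q) r"
proof (rule belowI)
  show "\<exists>r'. step r a r' \<and> below X s r'" if "step (p \<oplus> q) a s" for a s
    using that below_step[OF assms(1)] below_step[OF assms(2)] by (metis step_simps(4))
  show "initials r = {}" if "X = CS" "initials (p \<oplus> q) = {}"
    using that assms below_initials by auto
qed

lemma below_par_comm: "below X (p \<parallel> q) (q \<parallel> p)"
  by (rule below_coinduct[of "\<lambda>r s. \<exists>p q. r = p \<parallel> q \<and> s = q \<parallel> p"]) auto

lemma below_par_zero: "below X (p \<parallel> \<zero>) p"
  by (rule below_coinduct[of "\<lambda>r s. r = s \<parallel> \<zero>"]) auto

lemma below_zero_par: "below X p (p \<parallel> \<zero>)"
  by (rule below_coinduct[of "\<lambda>r s. s = r \<parallel> \<zero>"]) auto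

section \<open>Validity of the axioms\<close>

lemma below_E1:
  assumes "(t, u) \<in> E1"
  shows "below X (subst \<sigma> t) (subst \<sigma> u)" "below X (subst \<sigma> u) (subst \<sigma> t)"
proof -
  have *: "below X (r \<oplus> \<zero>) r" "below X r (r \<oplus> \<zero>)" "below X (r \<oplus> s) (s \<oplus> r)"
    "below X ((r \<oplus> s) \<oplus> v) (r \<oplus> (s \<oplus> v))" "below X (r \<oplus> (s \<oplus> v)) ((r \<oplus> s) \<oplus> v)"
    "below X (r \<oplus> r) r" "below X r (r \<oplus> r)" for r s v :: "'a trm"
    by (rule below_stepI; auto)+
  show "below X (subst \<sigma> t) (subst \<sigma> u)" "below X (subst \<sigma> u) (subst \<sigma> t)"
    using assms unfolding E1_def
    by (auto simp: * below_par_comm below_par_zero below_zero_par)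
qed

lemma below_EL1:
  assumes "(t, u) \<in> ax_EL1"
  shows "below X (subst \<sigma> t) (subst \<sigma> u)" "below X (subst \<sigma> u) (subst \<sigma> t)"
proof -
  show "below X (subst \<sigma> t) (subst \<sigma> u)"
    using assms unfolding ax_EL1_def by (auto intro!: below_stepI)
  show "below X (subst \<sigma> u) (subst \<sigma> t)"
    using assms unfolding ax_EL1_def
    by clarsimp (rule below_stepI; force)
qed

text \<open>Dropping \<open>y\<close> from \<open>bx \<oplus> y \<oplus> z\<close> only loses
  transitions, and the remaining prefix \<open>bx\<close> prevents a deadlock, so the completed
  preorder is respected too.\<close>

lemma below_CS:
  assumes "(t, u) \<in> ax_CS"
  shows "below X (subst \<sigma> t) (subst \<sigma> u)" "below X (subst \<sigma> u) (subst \<sigma> t)"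
proof -
  show "below X (subst \<sigma> t) (subst \<sigma> u)"
    using assms unfolding ax_CS_def by (auto intro!: below_stepI)
  show "below X (subst \<sigma> u) (subst \<sigma> t)"
    using assms unfolding ax_CS_def
    by clarsimp (rule below_plus_least; rule below_prefix; rule below_stepI; force)
qed

text \<open>A transition of the left side moves one summand of one argument; some summand on the
  right keeps that summand and the whole other argument, hence has the same derivative. Conversely
  each reduced argument is below the full one, since it keeps a prefix and so is not
  deadlocked.\<close>

lemma below_CSP1:
  assumes "(t, u) \<in> ax_CSP1"
  shows "below X (subst \<sigma> t) (subst \<sigma> u)" "below X (subst \<sigma> u) (subst \<sigma> t)"
proof -
  show "below X (subst \<sigma> t) (subst \<sigma> u)"
    using assms unfolding ax_CSP1_def by (auto intro!: below_stepI)
  show "below X (subst \<sigma> u) (subst \<sigma> t)"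
    using assms unfolding ax_CSP1_def
    by clarsimp (intro below_plus_least; (rule below_par; rule below_stepI; force)?; (rule below_stepI; force)?)
qed

lemma below_CSP2:
  assumes "(t, u) \<in> ax_CSP2"
  shows "below X (subst \<sigma> t) (subst \<sigma> u)" "below X (subst \<sigma> u) (subst \<sigma> t)"
proof -
  show "below X (subst \<sigma> t) (subst \<sigma> u)"
    using assms unfolding ax_CSP2_def by (auto intro!: below_stepI)
  show "below X (subst \<sigma> u) (subst \<sigma> t)"
    using assms unfolding ax_CSP2_def
    by clarsimp (intro below_plus_least; (rule below_par; rule below_stepI; force)?; (rule below_stepI; force)?)
qed

text \<open>Restricted to \<open>S\<close>: if \<open>x\<close> is deadlocked and \<open>y\<close>
  is not, the derivative \<open>x\<close> of \<open>ax\<close> cannot be matched by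
  \<open>x \<oplus> y\<close> in the completed preorder.\<close>

lemma below_S:
  assumes "(t, u) \<in> ax_S"
  shows "below S (subst \<sigma> t) (subst \<sigma> u)" "below S (subst \<sigma> u) (subst \<sigma> t)"
proof -
  show "below S (subst \<sigma> t) (subst \<sigma> u)"
    using assms unfolding ax_S_def by (auto intro!: below_stepI)
  show "below S (subst \<sigma> u) (subst \<sigma> t)"
    using assms unfolding ax_S_def
    by clarsimp (rule below_plus_least; rule below_prefix; rule below_stepI; force)
qed

lemma below_SP1:
  assumes "(t, u) \<in> ax_SP1"
  shows "below S (subst \<sigma> t) (subst \<sigma> u)" "below S (subst \<sigma> u) (subst \<sigma> t)"
proof -
  show "below S (subst \<sigma> t) (subst \<sigma> u)"
    using assms unfolding ax_SP1_def by (auto intro!: below_stepI)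
  show "below S (subst \<sigma> u) (subst \<sigma> t)"
    using assms unfolding ax_SP1_def
    by clarsimp (intro below_plus_least; (rule below_par; rule below_stepI; force)?; (rule below_stepI; force)?)
qed

lemma below_SP2:
  assumes "(t, u) \<in> ax_SP2"
  shows "below S (subst \<sigma> t) (subst \<sigma> u)" "below S (subst \<sigma> u) (subst \<sigma> t)"
proof -
  show "below S (subst \<sigma> t) (subst \<sigma> u)"
    using assms unfolding ax_SP2_def by (auto intro!: below_stepI)
  show "below S (subst \<sigma> u) (subst \<sigma> t)"
    using assms unfolding ax_SP2_def
    by clarsimp (intro below_plus_least; (rule below_par; rule below_stepI; force)?; (rule below_stepI; force)?)
qed

lemma below_axioms:
  assumes "(t, u) \<in> axioms_of X"
  shows "below X (subst \<sigma> t) (subst \<sigma> u) \<and> below X (subst \<sigma> u) (subst \<sigma> t)"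
  using assms below_E1 below_EL1 below_CS below_CSP1 below_CSP2 below_S below_SP1 below_SP2
  by (cases X) auto

text \<open>Induction on the derivation. Both inclusions are carried together because the symmetry
  rule exchanges them.\<close>

lemma derivable_imp_below:
  assumes "axioms_of X \<turnstile> t \<approx> u"
  shows "below X t u \<and> below X u t"
  using assms
proof induction
  case (trans t u v)
  then show ?case using below_trans by blast
qed (simp_all add: below_axioms below_prefix below_plus below_par)

section \<open>Derived equations\<close>

text \<open>The instantiated sides appear as equations, so that the simplifier evaluates
  \<open>subst\<close> instead of unification having to invert it.\<close>

lemma axiom_instance:
  assumes "(t, u) \<in> E" "t' = subst \<sigma> t" "u' = subst \<sigma> u"
  shows "E \<turnstile> t' \<approx> u'"
  using assms derivable.ax by blast

declare derivable.trans [trans]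

abbreviation eqX :: "'a trm \<Rightarrow> semantics \<Rightarrow> 'a trm \<Rightarrow> bool"
    ("(_ \<approx>[_] _)" [51, 0, 51] 50) where
  "t \<approx>[X] u \<equiv> axioms_of X \<turnstile> t \<approx> u"

lemma E1_subset: "E1 \<subseteq> axioms_of X"
  by (cases X) auto

lemma ax_EL1_subset: "ax_EL1 \<subseteq> axioms_of X"
  by (cases X) auto

text \<open>List lookup serves as substitution: variable number \<open>n\<close> goes to entry
  \<open>n\<close>, and the axioms mention only the variables 0 to 5. Axioms with fewer variables
  are padded with \<open>x\<close>.\<close>

abbreviation val6 :: "'a trm \<Rightarrow> 'a trm \<Rightarrow> 'a trm \<Rightarrow> 'a trm \<Rightarrow> 'a trm \<Rightarrow> 'a trm \<Rightarrow> nat \<Rightarrow> 'a trm"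
  where "val6 x y z w u v \<equiv> (!) [x, y, z, w, u, v]"

lemma plus_zero: "x \<oplus> \<zero> \<approx>[X] x"
  by (rule axiom_instance[OF subsetD[OF E1_subset],
        where t = "vx \<oplus> \<zero>" and \<sigma> = "val6 x x x x x x"]) (auto simp: E1_def)

lemma plus_comm: "x \<oplus> y \<approx>[X] y \<oplus> x"
  by (rule axiom_instance[OF subsetD[OF E1_subset],
        where t = "vx \<oplus> vy" and \<sigma> = "val6 x y x x x x"]) (auto simp: E1_def)

lemma plus_assoc: "(x \<oplus> y) \<oplus> z \<approx>[X] x \<oplus> (y \<oplus> z)"
  by (rule axiom_instance[OF subsetD[OF E1_subset],
        where t = "(vx \<oplus> vy) \<oplus> vz" and u = "vx \<oplus> (vy \<oplus> vz)" and \<sigma> = "val6 x y z x x x"])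
    (auto simp: E1_def)

lemma plus_idem: "x \<oplus> x \<approx>[X] x"
  by (rule axiom_instance[OF subsetD[OF E1_subset],
        where t = "vx \<oplus> vx" and u = vx and \<sigma> = "val6 x x x x x x"]) (auto simp: E1_def)

lemma par_zero: "x \<parallel> \<zero> \<approx>[X] x"
  by (rule axiom_instance[OF subsetD[OF E1_subset],
        where t = "vx \<parallel> \<zero>" and \<sigma> = "val6 x x x x x x"]) (auto simp: E1_def)

lemma par_comm: "x \<parallel> y \<approx>[X] y \<parallel> x"
  by (rule axiom_instance[OF subsetD[OF E1_subset],
        where t = "vx \<parallel> vy" and \<sigma> = "val6 x y x x x x"]) (auto simp: E1_def)

lemma EL1: "a\<cdot>x \<parallel> b\<cdot>y \<approx>[X] a\<cdot>(x \<parallel> b\<cdot>y) \<oplus> b\<cdot>(a\<cdot>x \<parallel> y)"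
  by (rule axiom_instance[OF subsetD[OF ax_EL1_subset],
        where t = "a\<cdot>vx \<parallel> b\<cdot>vy" and u = "a\<cdot>(vx \<parallel> b\<cdot>vy) \<oplus> b\<cdot>(a\<cdot>vx \<parallel> vy)"
          and \<sigma> = "val6 x y x x x x"])
    (auto simp: ax_EL1_def)

text \<open>The set of summands is invariant under A0 to A3. Prefixes, variables and parallel
  compositions count as atoms, and \<open>\<zero>\<close> contributes nothing.\<close>

fun summands :: "'a trm \<Rightarrow> 'a trm set" where
  "summands \<zero> = {}"
| "summands (t \<oplus> u) = summands t \<union> summands u"
| "summands t = {t}"

text \<open>Commutativity and associativity carry \<open>s\<close> to the branch that contains it,
  and idempotence removes it at the leaf.\<close>

lemma absorb_summand: "s \<in> summands t \<Longrightarrow> t \<oplus> s \<approx>[X] t"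
proof (induction t)
  case (Plus t u)
  show ?case
  proof (cases "s \<in> summands t")
    case True
    have "(t \<oplus> u) \<oplus> s \<approx>[X] s \<oplus> (t \<oplus> u)" by (rule plus_comm)
    also have "axioms_of X \<turnstile> \<dots> \<approx> (s \<oplus> t) \<oplus> u" by (rule derivable.sym, rule plus_assoc)
    also have "axioms_of X \<turnstile> \<dots> \<approx> (t \<oplus> s) \<oplus> u"
      by (intro derivable.cong_plus derivable.refl plus_comm)
    also have "axioms_of X \<turnstile> \<dots> \<approx> t \<oplus> u"
      by (intro derivable.cong_plus derivable.refl Plus.IH True)
    finally show ?thesis .
  next
    case False
    have "(t \<oplus> u) \<oplus> s \<approx>[X] t \<oplus> (u \<oplus> s)" by (rule plus_assoc)
    also have "axioms_of X \<turnstile> \<dots> \<approx> t \<oplus> u"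
      using False Plus.prems by (intro derivable.cong_plus derivable.refl Plus.IH) simp
    finally show ?thesis .
  qed
qed (auto intro: plus_idem)

lemma absorb_summands: "summands u \<subseteq> summands t \<Longrightarrow> t \<oplus> u \<approx>[X] t"
proof (induction u)
  case (Plus u v)
  have "t \<oplus> (u \<oplus> v) \<approx>[X] (t \<oplus> u) \<oplus> v" by (rule derivable.sym, rule plus_assoc)
  also have "axioms_of X \<turnstile> \<dots> \<approx> t \<oplus> v"
    using Plus by (intro derivable.cong_plus derivable.refl) auto
  also have "axioms_of X \<turnstile> \<dots> \<approx> t" using Plus by auto
  finally show ?case .
qed (auto intro: plus_zero absorb_summand)

text \<open>Each side absorbs the other, so \<open>t\<close>, \<open>t \<oplus> u\<close>,
  \<open>u \<oplus> t\<close> and \<open>u\<close> are all equal. Rearrangements by A0 to A3 thereby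
  become set equalities that automation can check.\<close>

lemma summands_eq:
  assumes "summands t = summands u"
  shows "t \<approx>[X] u"
proof -
  have "t \<approx>[X] t \<oplus> u" using assms by (intro derivable.sym[OF absorb_summands]) simp
  also have "axioms_of X \<turnstile> \<dots> \<approx> u \<oplus> t" by (rule plus_comm)
  also have "axioms_of X \<turnstile> \<dots> \<approx> u" using assms by (intro absorb_summands) simp
  finally show ?thesis .
qed

section \<open>The axioms of \<open>CS\<close> in both systems\<close>

lemma S_eq: "a\<cdot>(x \<oplus> y) \<approx>[S] a\<cdot>(x \<oplus> y) \<oplus> a\<cdot>x"
  by (rule axiom_instance[where t = "a\<cdot>(vx \<oplus> vy)" and u = "a\<cdot>(vx \<oplus> vy) \<oplus> a\<cdot>vx"
          and \<sigma> = "val6 x y x x x x"])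
    (auto simp: ax_S_def)

lemma SP1_eq:
  "(x \<oplus> y) \<parallel> (z \<oplus> w) \<approx>[S]
     x \<parallel> (z \<oplus> w) \<oplus> y \<parallel> (z \<oplus> w) \<oplus> (x \<oplus> y) \<parallel> z \<oplus> (x \<oplus> y) \<parallel> w"
  by (rule axiom_instance[where t = "(vx \<oplus> vy) \<parallel> (vz \<oplus> vw)"
          and u = "vx \<parallel> (vz \<oplus> vw) \<oplus> vy \<parallel> (vz \<oplus> vw) \<oplus> (vx \<oplus> vy) \<parallel> vz \<oplus> (vx \<oplus> vy) \<parallel> vw"
          and \<sigma> = "val6 x y z w x x"])
    (auto simp: ax_SP1_def)

lemma SP2_eq: "a\<cdot>x \<parallel> (y \<oplus> z) \<approx>[S] a\<cdot>(x \<parallel> (y \<oplus> z)) \<oplus> a\<cdot>x \<parallel> y \<oplus> a\<cdot>x \<parallel> z"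
  by (rule axiom_instance[where t = "a\<cdot>vx \<parallel> (vy \<oplus> vz)"
          and u = "a\<cdot>(vx \<parallel> (vy \<oplus> vz)) \<oplus> a\<cdot>vx \<parallel> vy \<oplus> a\<cdot>vx \<parallel> vz"
          and \<sigma> = "val6 x y z x x x"])
    (auto simp: ax_SP2_def)

lemma CS_eq:
  "a\<cdot>(b\<cdot>x \<oplus> y \<oplus> z) \<approx>[X] a\<cdot>(b\<cdot>x \<oplus> y \<oplus> z) \<oplus> a\<cdot>(b\<cdot>x \<oplus> z)"
proof (cases X)
  case CS
  show ?thesis unfolding CS
    by (rule axiom_instance[where t = "a\<cdot>(b\<cdot>vx \<oplus> vy \<oplus> vz)"
          and u = "a\<cdot>(b\<cdot>vx \<oplus> vy \<oplus> vz) \<oplus> a\<cdot>(b\<cdot>vx \<oplus> vz)" and \<sigma> = "val6 x y z x x x"])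
      (auto simp: ax_CS_def)
next
  case S
  \<comment> \<open>\<open>S\<close> keeps the left operand of a sum, so the summand
    \<open>y\<close> to be dropped is moved to the right end.\<close>
  have swap: "b\<cdot>x \<oplus> y \<oplus> z \<approx>[S] b\<cdot>x \<oplus> z \<oplus> y"
    by (rule summands_eq) auto
  have "a\<cdot>(b\<cdot>x \<oplus> y \<oplus> z) \<approx>[S] a\<cdot>(b\<cdot>x \<oplus> z \<oplus> y)"
    by (rule derivable.cong_prefix[OF swap])
  also have "axioms_of S \<turnstile> \<dots> \<approx> a\<cdot>(b\<cdot>x \<oplus> z \<oplus> y) \<oplus> a\<cdot>(b\<cdot>x \<oplus> z)"
    by (rule S_eq)
  also have "axioms_of S \<turnstile> \<dots> \<approx> a\<cdot>(b\<cdot>x \<oplus> y \<oplus> z) \<oplus> a\<cdot>(b\<cdot>x \<oplus> z)"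
    by (intro derivable.cong_plus derivable.refl derivable.cong_prefix derivable.sym[OF swap])
  finally show ?thesis unfolding S .
qed

lemma CSP1_eq:
  "(a\<cdot>x \<oplus> b\<cdot>y \<oplus> u) \<parallel> (c\<cdot>z \<oplus> d\<cdot>w \<oplus> v) \<approx>[X]
     (a\<cdot>x \<oplus> u) \<parallel> (c\<cdot>z \<oplus> d\<cdot>w \<oplus> v)
     \<oplus> (b\<cdot>y \<oplus> u) \<parallel> (c\<cdot>z \<oplus> d\<cdot>w \<oplus> v)
     \<oplus> (a\<cdot>x \<oplus> b\<cdot>y \<oplus> u) \<parallel> (c\<cdot>z \<oplus> v)
     \<oplus> (a\<cdot>x \<oplus> b\<cdot>y \<oplus> u) \<parallel> (d\<cdot>w \<oplus> v)"
proof (cases X)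
  case CS
  show ?thesis unfolding CS
    by (rule axiom_instance[where
          t = "(a\<cdot>vx \<oplus> b\<cdot>vy \<oplus> vu) \<parallel> (c\<cdot>vz \<oplus> d\<cdot>vw \<oplus> vv)"
          and u = "(a\<cdot>vx \<oplus> vu) \<parallel> (c\<cdot>vz \<oplus> d\<cdot>vw \<oplus> vv)
            \<oplus> (b\<cdot>vy \<oplus> vu) \<parallel> (c\<cdot>vz \<oplus> d\<cdot>vw \<oplus> vv)
            \<oplus> (a\<cdot>vx \<oplus> b\<cdot>vy \<oplus> vu) \<parallel> (c\<cdot>vz \<oplus> vv)
            \<oplus> (a\<cdot>vx \<oplus> b\<cdot>vy \<oplus> vu) \<parallel> (d\<cdot>vw \<oplus> vv)"
          and \<sigma> = "val6 x y z w u v"])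
      (auto simp: ax_CSP1_def)
next
  case S
  \<comment> \<open>Applied to both arguments: each is split into two halves that carry their own
    copy of the context \<open>u\<close> or \<open>v\<close>, which is the shape \<open>SP1\<close>
    needs.\<close>
  have dup: "p \<oplus> q \<oplus> r \<approx>[S] (p \<oplus> r) \<oplus> (q \<oplus> r)" for p q r :: "'a trm"
    by (rule summands_eq) auto
  have "(a\<cdot>x \<oplus> b\<cdot>y \<oplus> u) \<parallel> (c\<cdot>z \<oplus> d\<cdot>w \<oplus> v) \<approx>[S]
      ((a\<cdot>x \<oplus> u) \<oplus> (b\<cdot>y \<oplus> u)) \<parallel> ((c\<cdot>z \<oplus> v) \<oplus> (d\<cdot>w \<oplus> v))"
    by (intro derivable.cong_par dup)
  also have "axioms_of S \<turnstile> \<dots> \<approx>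
      (a\<cdot>x \<oplus> u) \<parallel> ((c\<cdot>z \<oplus> v) \<oplus> (d\<cdot>w \<oplus> v))
      \<oplus> (b\<cdot>y \<oplus> u) \<parallel> ((c\<cdot>z \<oplus> v) \<oplus> (d\<cdot>w \<oplus> v))
      \<oplus> ((a\<cdot>x \<oplus> u) \<oplus> (b\<cdot>y \<oplus> u)) \<parallel> (c\<cdot>z \<oplus> v)
      \<oplus> ((a\<cdot>x \<oplus> u) \<oplus> (b\<cdot>y \<oplus> u)) \<parallel> (d\<cdot>w \<oplus> v)"
    by (rule SP1_eq)
  also have "axioms_of S \<turnstile> \<dots> \<approx>
      (a\<cdot>x \<oplus> u) \<parallel> (c\<cdot>z \<oplus> d\<cdot>w \<oplus> v)
      \<oplus> (b\<cdot>y \<oplus> u) \<parallel> (c\<cdot>z \<oplus> d\<cdot>w \<oplus> v)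
      \<oplus> (a\<cdot>x \<oplus> b\<cdot>y \<oplus> u) \<parallel> (c\<cdot>z \<oplus> v)
      \<oplus> (a\<cdot>x \<oplus> b\<cdot>y \<oplus> u) \<parallel> (d\<cdot>w \<oplus> v)"
    by (intro derivable.cong_plus derivable.cong_par derivable.refl derivable.sym[OF dup])
  finally show ?thesis unfolding S .
qed

lemma CSP2_eq:
  "a\<cdot>x \<parallel> (b\<cdot>y \<oplus> c\<cdot>z \<oplus> w) \<approx>[X]
     a\<cdot>(x \<parallel> (b\<cdot>y \<oplus> c\<cdot>z \<oplus> w)) \<oplus> a\<cdot>x \<parallel> (b\<cdot>y \<oplus> w) \<oplus> a\<cdot>x \<parallel> (c\<cdot>z \<oplus> w)"
proof (cases X)
  case CS
  show ?thesis unfolding CS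
    by (rule axiom_instance[where t = "a\<cdot>vx \<parallel> (b\<cdot>vy \<oplus> c\<cdot>vz \<oplus> vw)"
          and u = "a\<cdot>(vx \<parallel> (b\<cdot>vy \<oplus> c\<cdot>vz \<oplus> vw))
            \<oplus> a\<cdot>vx \<parallel> (b\<cdot>vy \<oplus> vw) \<oplus> a\<cdot>vx \<parallel> (c\<cdot>vz \<oplus> vw)"
          and \<sigma> = "val6 x y z w x x"])
      (auto simp: ax_CSP2_def)
next
  case S
  have dup: "b\<cdot>y \<oplus> c\<cdot>z \<oplus> w \<approx>[S] (b\<cdot>y \<oplus> w) \<oplus> (c\<cdot>z \<oplus> w)"
    by (rule summands_eq) auto
  have "a\<cdot>x \<parallel> (b\<cdot>y \<oplus> c\<cdot>z \<oplus> w) \<approx>[S] a\<cdot>x \<parallel> ((b\<cdot>y \<oplus> w) \<oplus> (c\<cdot>z \<oplus> w))"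
    by (intro derivable.cong_par derivable.refl dup)
  also have "axioms_of S \<turnstile> \<dots> \<approx>
      a\<cdot>(x \<parallel> ((b\<cdot>y \<oplus> w) \<oplus> (c\<cdot>z \<oplus> w))) \<oplus> a\<cdot>x \<parallel> (b\<cdot>y \<oplus> w) \<oplus> a\<cdot>x \<parallel> (c\<cdot>z \<oplus> w)"
    by (rule SP2_eq)
  also have "axioms_of S \<turnstile> \<dots> \<approx>
      a\<cdot>(x \<parallel> (b\<cdot>y \<oplus> c\<cdot>z \<oplus> w)) \<oplus> a\<cdot>x \<parallel> (b\<cdot>y \<oplus> w) \<oplus> a\<cdot>x \<parallel> (c\<cdot>z \<oplus> w)"
    by (intro derivable.cong_plus derivable.cong_prefix derivable.cong_par derivable.refl
        derivable.sym[OF dup])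
  finally show ?thesis unfolding S .
qed

section \<open>Elimination of parallel composition\<close>

text \<open>Lists of prefixes, with \<open>\<oplus>\<close> as cons and \<open>\<zero>\<close> as
  the empty list at the end. A normal form other than \<open>\<zero>\<close> thus exhibits a prefix
  at its head, as the axioms of \<open>CS\<close> demand.\<close>

inductive nf :: "'a trm \<Rightarrow> bool" where
  nf_zero: "nf \<zero>"
| nf_plus: "nf p \<Longrightarrow> nf q \<Longrightarrow> nf (a\<cdot>p \<oplus> q)"

definition has_nf :: "semantics \<Rightarrow> 'a trm \<Rightarrow> bool" where
  "has_nf X t \<longleftrightarrow> (\<exists>n. nf n \<and> t \<approx>[X] n)"

lemma has_nfI: "nf n \<Longrightarrow> t \<approx>[X] n \<Longrightarrow> has_nf X t"
  unfolding has_nf_def by auto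

lemma has_nfE:
  assumes "has_nf X t"
  obtains n where "nf n" "t \<approx>[X] n"
  using assms unfolding has_nf_def by auto

lemma has_nf_nf: "nf n \<Longrightarrow> has_nf X n"
  by (rule has_nfI) (auto intro: derivable.refl)

lemma has_nf_cong: "t \<approx>[X] u \<Longrightarrow> has_nf X u \<Longrightarrow> has_nf X t"
  by (metis has_nfE has_nfI derivable.trans)

lemma has_nf_prefix:
  assumes "has_nf X t"
  shows "has_nf X (a\<cdot>t)"
proof -
  obtain n where "nf n" and "t \<approx>[X] n" using assms by (rule has_nfE)
  have "a\<cdot>t \<approx>[X] a\<cdot>n" using \<open>t \<approx>[X] n\<close> by (rule derivable.cong_prefix)
  also have "axioms_of X \<turnstile> \<dots> \<approx> a\<cdot>n \<oplus> \<zero>" by (rule summands_eq) simp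
  finally show ?thesis
    using nf_plus[OF \<open>nf n\<close> nf_zero] by (intro has_nfI)
qed

text \<open>The analogue of appending lists: associativity moves \<open>n\<close> inwards until it
  replaces the final \<open>\<zero>\<close> of \<open>m\<close>.\<close>

lemma nf_plus_has_nf:
  assumes "nf m" "nf n"
  shows "has_nf X (m \<oplus> n)"
  using assms(1)
proof induction
  case nf_zero
  have "\<zero> \<oplus> n \<approx>[X] n" by (rule summands_eq) simp
  then show ?case using assms(2) by (intro has_nfI)
next
  case (nf_plus p q a)
  obtain k where "nf k" and k: "q \<oplus> n \<approx>[X] k" using nf_plus.IH(2) by (rule has_nfE)
  have "(a\<cdot>p \<oplus> q) \<oplus> n \<approx>[X] a\<cdot>p \<oplus> (q \<oplus> n)" by (rule plus_assoc)
  also have "axioms_of X \<turnstile> \<dots> \<approx> a\<cdot>p \<oplus> k"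
    by (intro derivable.cong_plus derivable.refl k)
  finally show ?case
    using nf.nf_plus[OF \<open>nf p\<close> \<open>nf k\<close>] by (intro has_nfI)
qed

lemma has_nf_plus:
  assumes "has_nf X t" "has_nf X u"
  shows "has_nf X (t \<oplus> u)"
proof -
  obtain m n where "nf m" "nf n" "t \<approx>[X] m" "u \<approx>[X] n"
    using assms by (metis has_nfE)
  then show ?thesis
    by (intro has_nf_cong[OF derivable.cong_plus nf_plus_has_nf])
qed

text \<open>The cases match the axioms for parallel composition: P0 handles \<open>\<zero>\<close>,
  \<open>EL1\<close> one prefix against one, and \<open>CSP1\<close> and \<open>CSP2\<close> need an
  argument with at least two.\<close>

lemma nf_cases3:
  assumes "nf n"
  obtains "n = \<zero>"
    | a p where "n = a\<cdot>p \<oplus> \<zero>" "nf p"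
    | a p b q r where "n = a\<cdot>p \<oplus> (b\<cdot>q \<oplus> r)" "nf p" "nf q" "nf r"
  using assms by (metis nf.cases)

text \<open>\<open>CSP2\<close> leaves three parallel compositions, each smaller: the first loses
  the prefix of \<open>m\<close>, the others lose a summand of \<open>n\<close>. The induction
  hypothesis is a premise so that the lemma serves for either order of the arguments.\<close>

lemma nf_single_par_many:
  fixes m n :: "'a trm"
  assumes IH: "\<And>m' n' :: 'a trm. size m' + size n' < size m + size n \<Longrightarrow> nf m' \<Longrightarrow> nf n' \<Longrightarrow>
      has_nf X (m' \<parallel> n')"
    and m: "m = a\<cdot>x \<oplus> \<zero>" "nf x" and n: "n = b\<cdot>y \<oplus> (c\<cdot>z \<oplus> w)" "nf y" "nf z" "nf w"
  shows "has_nf X (m \<parallel> n)"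
proof -
  have "m \<parallel> n \<approx>[X] a\<cdot>x \<parallel> (b\<cdot>y \<oplus> c\<cdot>z \<oplus> w)"
    unfolding m n by (intro derivable.cong_par summands_eq) auto
  also have "axioms_of X \<turnstile> \<dots> \<approx>
      a\<cdot>(x \<parallel> (b\<cdot>y \<oplus> c\<cdot>z \<oplus> w)) \<oplus> a\<cdot>x \<parallel> (b\<cdot>y \<oplus> w) \<oplus> a\<cdot>x \<parallel> (c\<cdot>z \<oplus> w)"
    by (rule CSP2_eq)
  \<comment> \<open>The arguments are folded back into \<open>m\<close> and \<open>n\<close>, since
    \<open>a\<cdot>x\<close> without its final \<open>\<zero>\<close> is not a normal form.\<close>
  also have "axioms_of X \<turnstile> \<dots> \<approx> a\<cdot>(x \<parallel> n) \<oplus> m \<parallel> (b\<cdot>y \<oplus> w) \<oplus> m \<parallel> (c\<cdot>z \<oplus> w)"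
    unfolding m n
    by (intro derivable.cong_plus derivable.cong_prefix derivable.cong_par derivable.refl
        summands_eq) auto
  finally show ?thesis
    by (rule has_nf_cong, intro has_nf_plus has_nf_prefix IH) (use m n in \<open>auto intro: nf.intros\<close>)
qed

lemma nf_par: "nf m \<Longrightarrow> nf n \<Longrightarrow> has_nf X (m \<parallel> n)"
proof (induction "size m + size n" arbitrary: m n rule: less_induct)
  case less
  note IH = less.hyps
  show ?case
    using \<open>nf m\<close>
  proof (cases rule: nf_cases3)
    case 1
    have "m \<parallel> n \<approx>[X] n" unfolding 1 by (rule derivable.trans[OF par_comm par_zero])
    then show ?thesis using \<open>nf n\<close> by (intro has_nfI)
  next
    case m: (2 a x)
    show ?thesis
      using \<open>nf n\<close>
    proof (cases rule: nf_cases3)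
      case 1
      show ?thesis unfolding 1 using \<open>nf m\<close> par_zero by (rule has_nfI)
    next
      case n: (2 b y)
      have "m \<parallel> n \<approx>[X] a\<cdot>x \<parallel> b\<cdot>y"
        unfolding m n by (intro derivable.cong_par summands_eq) auto
      also have "axioms_of X \<turnstile> \<dots> \<approx> a\<cdot>(x \<parallel> b\<cdot>y) \<oplus> b\<cdot>(a\<cdot>x \<parallel> y)"
        by (rule EL1)
      also have "axioms_of X \<turnstile> \<dots> \<approx> a\<cdot>(x \<parallel> n) \<oplus> b\<cdot>(m \<parallel> y)"
        unfolding m n
        by (intro derivable.cong_plus derivable.cong_prefix derivable.cong_par derivable.refl
            summands_eq) auto
      finally show ?thesis
        by (rule has_nf_cong, intro has_nf_plus has_nf_prefix IH)
          (use m n less.prems in auto)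
    next
      case n: (3 b y c z w)
      show ?thesis by (rule nf_single_par_many[OF IH m n])
    qed
  next
    case m: (3 a x b y u)
    show ?thesis
      using \<open>nf n\<close>
    proof (cases rule: nf_cases3)
      case 1
      show ?thesis unfolding 1 using \<open>nf m\<close> par_zero by (rule has_nfI)
    next
      case n: (2 c z)
      \<comment> \<open>Here \<open>n\<close> is the single prefix, so the arguments change places;
        the measure is a symmetric sum of sizes.\<close>
      have "has_nf X (n \<parallel> m)"
        by (rule nf_single_par_many[OF IH n m]) auto
      then show ?thesis by (rule has_nf_cong[OF par_comm])
    next
      case n: (3 c z d w v)
      have assoc: "a\<cdot>x \<oplus> b\<cdot>y \<oplus> u \<approx>[X] m" "c\<cdot>z \<oplus> d\<cdot>w \<oplus> v \<approx>[X] n"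
        unfolding m n by (rule plus_assoc)+
      have "m \<parallel> n \<approx>[X] (a\<cdot>x \<oplus> b\<cdot>y \<oplus> u) \<parallel> (c\<cdot>z \<oplus> d\<cdot>w \<oplus> v)"
        by (intro derivable.cong_par derivable.sym[OF assoc(1)] derivable.sym[OF assoc(2)])
      also have "axioms_of X \<turnstile> \<dots> \<approx>
          (a\<cdot>x \<oplus> u) \<parallel> (c\<cdot>z \<oplus> d\<cdot>w \<oplus> v)
          \<oplus> (b\<cdot>y \<oplus> u) \<parallel> (c\<cdot>z \<oplus> d\<cdot>w \<oplus> v)
          \<oplus> (a\<cdot>x \<oplus> b\<cdot>y \<oplus> u) \<parallel> (c\<cdot>z \<oplus> v)
          \<oplus> (a\<cdot>x \<oplus> b\<cdot>y \<oplus> u) \<parallel> (d\<cdot>w \<oplus> v)"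
        by (rule CSP1_eq)
      also have "axioms_of X \<turnstile> \<dots> \<approx>
          (a\<cdot>x \<oplus> u) \<parallel> n \<oplus> (b\<cdot>y \<oplus> u) \<parallel> n \<oplus> m \<parallel> (c\<cdot>z \<oplus> v) \<oplus> m \<parallel> (d\<cdot>w \<oplus> v)"
        by ((rule derivable.cong_plus)+; rule derivable.cong_par; rule derivable.refl assoc)
      finally show ?thesis
        by (rule has_nf_cong, intro has_nf_plus IH)
          (use m n less.prems in \<open>auto intro: nf.intros\<close>)
    qed
  qed
qed

lemma has_nf_par:
  assumes "has_nf X t" "has_nf X u"
  shows "has_nf X (t \<parallel> u)"
proof -
  obtain m n where "nf m" "nf n" "t \<approx>[X] m" "u \<approx>[X] n"
    using assms by (metis has_nfE)
  then show ?thesis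
    by (intro has_nf_cong[OF derivable.cong_par nf_par])
qed

lemma process_has_nf: "process p \<Longrightarrow> has_nf X p"
  by (induction p) (auto intro: has_nf_prefix has_nf_plus has_nf_par has_nf_nf nf_zero)

section \<open>Completeness\<close>

lemma nf_step: "nf q \<Longrightarrow> step q a q' \<Longrightarrow> nf q' \<and> a\<cdot>q' \<in> summands q"
  by (induction rule: nf.induct) auto

lemma nf_initials_empty: "nf p \<Longrightarrow> initials p = {} \<longleftrightarrow> p = \<zero>"
  by (cases rule: nf.cases) auto

text \<open>If \<open>p\<close> has a head prefix \<open>b\<cdot>x\<close>, then \<open>q\<close>
  can be written as \<open>b\<cdot>x \<oplus> q \<oplus> z\<close>, and \<open>CS\<close> with
  \<open>q\<close> in the place of \<open>y\<close> yields the summand \<open>a\<cdot>p\<close>. If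
  \<open>p\<close> is \<open>\<zero>\<close>, either the deadlock condition forces \<open>q\<close>
  to be \<open>\<zero>\<close>, or \<open>S\<close> applies with \<open>x\<close> as
  \<open>\<zero>\<close>.\<close>

lemma prefix_absorb:
  assumes "nf p" "nf q" and below: "below X p q" and q: "q \<approx>[X] q \<oplus> p"
  shows "a\<cdot>q \<approx>[X] a\<cdot>q \<oplus> a\<cdot>p"
  using \<open>nf p\<close>
proof cases
  case nf_zero
  show ?thesis
  proof (cases X)
    case CS
    then have "q = \<zero>"
      using below_initials[of p q] below nf_zero nf_initials_empty[OF \<open>nf q\<close>] by simp
    then show ?thesis
      unfolding nf_zero by (intro summands_eq) simp
  next
    case S
    have "\<zero> \<oplus> q \<approx>[S] q" by (rule summands_eq) simp
    then have "a\<cdot>(\<zero> \<oplus> q) \<approx>[S] a\<cdot>q" by (rule derivable.cong_prefix)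
    then show ?thesis
      unfolding S nf_zero
      using S_eq[of a \<zero> q] by (meson derivable.intros)
  qed
next
  case (nf_plus x z b)
  have eq: "a\<cdot>q \<approx>[X] a\<cdot>(b\<cdot>x \<oplus> q \<oplus> z)"
  proof (rule derivable.cong_prefix)
    note q
    also have "axioms_of X \<turnstile> q \<oplus> p \<approx> b\<cdot>x \<oplus> q \<oplus> z"
      unfolding nf_plus by (rule summands_eq) auto
    finally show "q \<approx>[X] b\<cdot>x \<oplus> q \<oplus> z" .
  qed
  also have "axioms_of X \<turnstile> \<dots> \<approx> a\<cdot>(b\<cdot>x \<oplus> q \<oplus> z) \<oplus> a\<cdot>(b\<cdot>x \<oplus> z)"
    by (rule CS_eq)
  also have "axioms_of X \<turnstile> \<dots> \<approx> a\<cdot>q \<oplus> a\<cdot>p"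
    unfolding nf_plus(1)[symmetric]
    by (intro derivable.cong_plus derivable.refl derivable.sym[OF eq])
  finally show ?thesis .
qed

text \<open>Only the transfer of transitions is assumed, not \<open>below\<close>: it passes to the
  tail of a normal form, whereas the deadlock condition may fail there when the tail is
  \<open>\<zero>\<close>.\<close>

lemma nf_below_absorb:
  assumes "nf p" "nf q" and "\<And>a p'. step p a p' \<Longrightarrow> \<exists>q'. step q a q' \<and> below X p' q'"
  shows "q \<approx>[X] q \<oplus> p"
  using assms
proof (induction arbitrary: q)
  case nf_zero
  show ?case by (rule summands_eq) simp
next
  case (nf_plus p r a)
  obtain q' where q': "step q a q'" "below X p q'" using nf_plus.prems(2)[of a p] by auto
  have "nf q'" and in_q: "a\<cdot>q' \<in> summands q"
    using nf_step[OF nf_plus.prems(1) q'(1)] by auto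
  have "q' \<approx>[X] q' \<oplus> p"
    by (rule nf_plus.IH(1)[OF \<open>nf q'\<close> below_step[OF q'(2)]])
  then have absorb: "a\<cdot>q' \<approx>[X] a\<cdot>q' \<oplus> a\<cdot>p"
    by (rule prefix_absorb[OF \<open>nf p\<close> \<open>nf q'\<close> q'(2)])
  have "q \<approx>[X] q \<oplus> r"
    using nf_plus.prems by (intro nf_plus.IH(2)) auto
  \<comment> \<open>A copy of the matching summand \<open>a\<cdot>q'\<close> of \<open>q\<close> is
    split off, expanded by \<open>a\<cdot>p\<close>, and merged back into \<open>q\<close>.\<close>
  also have "axioms_of X \<turnstile> \<dots> \<approx> (q \<oplus> r) \<oplus> a\<cdot>q'"
    by (rule summands_eq) (use in_q in auto)
  also have "axioms_of X \<turnstile> \<dots> \<approx> (q \<oplus> r) \<oplus> (a\<cdot>q' \<oplus> a\<cdot>p)"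
    by (intro derivable.cong_plus derivable.refl absorb)
  also have "axioms_of X \<turnstile> \<dots> \<approx> q \<oplus> (a\<cdot>p \<oplus> r)"
    by (rule summands_eq) (use in_q in auto)
  finally show ?case .
qed

lemma below_antisym_derivable:
  assumes "process p" "process q" "below X p q" "below X q p"
  shows "p \<approx>[X] q"
proof -
  obtain m n where m: "nf m" "p \<approx>[X] m" and n: "nf n" "q \<approx>[X] n"
    using process_has_nf assms(1,2) by (metis has_nfE)
  \<comment> \<open>Soundness carries the comparison from \<open>p\<close> and \<open>q\<close> over
    to their normal forms.\<close>
  have "below X m n" "below X n m"
    using assms(3,4) derivable_imp_below[OF m(2)] derivable_imp_below[OF n(2)]
    by (metis below_trans)+
  then have "n \<approx>[X] n \<oplus> m" "m \<approx>[X] m \<oplus> n"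
    using nf_below_absorb m(1) n(1) below_step by metis+
  then have "m \<approx>[X] n"
    using plus_comm by (meson derivable.trans derivable.sym)
  then show ?thesis
    using m(2) n(2) by (meson derivable.trans derivable.sym)
qed

theorem theorem4p6:
  fixes X :: semantics and p q :: "'a::finite trm"
  assumes "process p" and "process q"
  shows "p \<sim>[X] q \<longleftrightarrow> axioms_of X \<turnstile> p \<approx> q"
  using assms below_antisym_derivable[of p q X] derivable_imp_below[of X p q]
  by (auto simp: sem_equiv_def preord_iff_below)

end
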